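(* Let $X$ be a topological space, let $\mathcal D$ be a network of compact subsets of $X$ and let $Y\in C(X,\$)$. If $C_{\alpha_{\mathcal D}}(X,\$)$ is Fréchet at $Y$, then $C_{\alpha_{\mathcal D}}(X,\$)$ is Fréchet-Urysohn for finite sets at $Y$.
   Context: $C(X,\$)$ is the set of open subsets of $X$. For $D\subseteq X$, $\mathcal O_X(D)$ is the set of open subsets of $X$ containing $D$. A network on $X$ is a family $\mathcal D$ of subsets such that for each $x\in X$ and open $U\ni x$ there is $D\in\mathcal D$ with $x\in D\subseteq U$. $\alpha_{\mathcal D}=\{\mathcal O_X(D):D\in\mathcal D\}$, and $C_{\alpha_{\mathcal D}}(X,\$)$ is $C(X,\$)$ with the topology generated by $\alpha_{\mathcal D}$ (by the paper's convention, $\alpha_{\mathcal D}$ may be assumed to be a base of this topology, replacing it by its finite intersections). A topological space $S$ is Fréchet at $s$ if whenever $s\in\mathrm{cl}\,A$ there is a sequence in $A$ converging to $s$. $S$ is Fréchet-Urysohn for finite sets (FU$_{fin}$) at $s$ if for every family $\mathcal P$ of finite subsets of $S$ such that each open neighborhood of $s$ contains (as a subset) an element of $\mathcal P$, there is a sequence $(P_n)_{n\in\omega}$ of elements of $\mathcal P$ such that each open neighborhood of $s$ contains all but finitely many of the $P_n$. *)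

theory Defs
  imports "HOL-Analysis.Analysis"
begin

definition open_subsets :: "'a topology \<Rightarrow> 'a set set" where
  "open_subsets X = {U. openin X U}"

definition open_supersets :: "'a topology \<Rightarrow> 'a set \<Rightarrow> 'a set set" where
  "open_supersets X D = {U. openin X U \<and> D \<subseteq> U}"

definition network_on :: "'a topology \<Rightarrow> 'a set set \<Rightarrow> bool" where
  "network_on X \<D> \<longleftrightarrow>
     (\<forall>D\<in>\<D>. D \<subseteq> topspace X) \<and>
     (\<forall>x U. openin X U \<and> x \<in> U \<longrightarrow> (\<exists>D\<in>\<D>. x \<in> D \<and> D \<subseteq> U))"

definition alpha_family :: "'a topology \<Rightarrow> 'a set set \<Rightarrow> 'a set set set" where
  "alpha_family X \<D> = open_supersets X ` \<D>"

text \<open>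
  The set of open subsets of \<open>X\<close>, with the topology having \<open>\<alpha>\<close> as a subbase.
  The empty intersection counts as the whole set of open subsets, hence the relativization:
  \<open>topology_generated_by \<alpha>\<close> alone has carrier \<open>\<Union>\<alpha>\<close>, which for \<open>\<alpha> = alpha_family X \<D>\<close>
  omits the empty open set unless \<open>{} \<in> \<D>\<close>.
\<close>
definition open_subsets_topology :: "'a topology \<Rightarrow> 'a set set set \<Rightarrow> 'a set topology" where
  "open_subsets_topology X \<alpha> =
     topology (arbitrary union_of (finite intersection_of (\<lambda>W. W \<in> \<alpha>) relative_to open_subsets X))"

lemma topspace_open_subsets_topology [simp]:
  "topspace (open_subsets_topology X \<alpha>) = open_subsets X"
  by (simp add: open_subsets_topology_def topspace_subbase)

definition frechet_at :: "'a topology \<Rightarrow> 'a \<Rightarrow> bool" where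
  "frechet_at S s \<longleftrightarrow>
     (\<forall>A. A \<subseteq> topspace S \<and> s \<in> S closure_of A \<longrightarrow>
        (\<exists>a :: nat \<Rightarrow> 'a. range a \<subseteq> A \<and> limitin S a s sequentially))"

definition frechet_urysohn_fin_at :: "'a topology \<Rightarrow> 'a \<Rightarrow> bool" where
  "frechet_urysohn_fin_at S s \<longleftrightarrow>
     (\<forall>\<P>. (\<forall>P\<in>\<P>. finite P \<and> P \<subseteq> topspace S) \<and>
          (\<forall>U. openin S U \<and> s \<in> U \<longrightarrow> (\<exists>P\<in>\<P>. P \<subseteq> U)) \<longrightarrow>
        (\<exists>p :: nat \<Rightarrow> 'a set. range p \<subseteq> \<P> \<and>
           (\<forall>U. openin S U \<and> s \<in> U \<longrightarrow> (\<forall>\<^sub>F n in sequentially. p n \<subseteq> U))))"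

end

theory Submission
  imports Defs
begin

text \<open>
  The basic neighbourhoods of \<open>Y\<close> have the form \<open>open_supersets X K\<close>, where \<open>K\<close> is a finite union
  of members of \<open>\<D>\<close>. Such a neighbourhood is a filter of open sets: it contains a finite set \<open>P\<close> of
  open sets if and only if it contains the single open set \<open>topspace X \<inter> \<Inter>P\<close>.

  So replacing each member \<open>P\<close> of a family \<open>\<P>\<close> by this intersection translates statements about
  finite sets into statements about points: if every neighbourhood of \<open>Y\<close> contains a member of
  \<open>\<P>\<close>, then \<open>Y\<close> lies in the closure of the set of intersections, and a sequence of intersections
  converging to \<open>Y\<close> comes from a sequence in \<open>\<P>\<close> that is eventually contained in each
  neighbourhood of \<open>Y\<close>.
\<close>

text \<open>
  The union \<open>\<Union>\<F>\<close> arises because \<open>open_supersets\<close> turns unions into intersections; \<open>\<F>\<close> may be empty,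
  which gives the whole space.
\<close>
lemma openin_open_subsets_topology_obtain_basic:
  assumes "openin (open_subsets_topology X (alpha_family X \<D>)) U" and "Y \<in> U"
  obtains \<F> where "finite \<F>" "\<F> \<subseteq> \<D>"
    "Y \<in> open_supersets X (\<Union>\<F>)" "open_supersets X (\<Union>\<F>) \<subseteq> U"
proof -
  have "(arbitrary union_of
      (finite intersection_of (\<lambda>W. W \<in> alpha_family X \<D>) relative_to open_subsets X)) U"
    using assms(1) by (simp add: open_subsets_topology_def openin_subbase)
  then obtain B where "Y \<in> B" "B \<subseteq> U"
    and "((finite intersection_of (\<lambda>W. W \<in> alpha_family X \<D>)) relative_to open_subsets X) B"
    using assms(2) unfolding union_of_def by blast
  then obtain \<W> where \<W>: "finite \<W>" "\<W> \<subseteq> alpha_family X \<D>"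
    and Y: "Y \<in> open_subsets X \<inter> \<Inter>\<W>" and sub: "open_subsets X \<inter> \<Inter>\<W> \<subseteq> U"
    unfolding relative_to_def intersection_of_def by blast
  obtain \<F> where \<F>: "finite \<F>" "\<F> \<subseteq> \<D>" "\<W> = open_supersets X ` \<F>"
    using \<W> unfolding alpha_family_def by (meson finite_subset_image)
  have eq: "open_subsets X \<inter> \<Inter>\<W> = open_supersets X (\<Union>\<F>)"
    unfolding \<F>(3) open_subsets_def open_supersets_def by auto
  show thesis
    by (rule that[OF \<F>(1,2) Y[unfolded eq] sub[unfolded eq]])
qed

text \<open>
  Finiteness of \<open>P\<close> makes the intersection open. Intersecting with \<open>topspace X\<close> matters only for
  \<open>P = {}\<close>, where \<open>\<Inter>P\<close> is the whole type; both sides are then true.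
\<close>
lemma subset_open_supersets_iff_Inter:
  assumes "finite P" and "P \<subseteq> open_subsets X" and "K \<subseteq> topspace X"
  shows "P \<subseteq> open_supersets X K \<longleftrightarrow> topspace X \<inter> \<Inter>P \<in> open_supersets X K"
proof -
  have "openin X (topspace X \<inter> \<Inter>P)"
    using assms(1,2) unfolding open_subsets_def by (auto intro: openin_Int_Inter)
  then show ?thesis
    using assms(2,3) unfolding open_supersets_def open_subsets_def by auto
qed

lemma openin_open_supersets_Union:
  assumes "finite \<F>" and "\<F> \<subseteq> \<D>"
  shows "openin (open_subsets_topology X (alpha_family X \<D>)) (open_supersets X (\<Union>\<F>))"
proof -
  have "open_supersets X (\<Union>\<F>) = open_subsets X \<inter> \<Inter>(open_supersets X ` \<F>)"
    unfolding open_subsets_def open_supersets_def by auto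
  moreover have "(finite intersection_of (\<lambda>W. W \<in> alpha_family X \<D>))
      (\<Inter>(open_supersets X ` \<F>))"
    using assms unfolding intersection_of_def alpha_family_def by blast
  ultimately show ?thesis
    unfolding open_subsets_topology_def openin_subbase
    by (metis arbitrary_union_of_inc relative_to_inc)
qed

theorem theorem11p2:
  fixes X :: "'a topology" and \<D> :: "'a set set" and Y :: "'a set"
  assumes "network_on X \<D>"
    and "\<And>D. D \<in> \<D> \<Longrightarrow> compactin X D"
    and "Y \<in> open_subsets X"
    and "frechet_at (open_subsets_topology X (alpha_family X \<D>)) Y"
  shows "frechet_urysohn_fin_at (open_subsets_topology X (alpha_family X \<D>)) Y"
  unfolding frechet_urysohn_fin_at_def
proof (intro allI impI, elim conjE)
  let ?S = "open_subsets_topology X (alpha_family X \<D>)"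
  let ?i = "\<lambda>P. topspace X \<inter> \<Inter>P"
  fix \<P>
  assume fin: "\<forall>P\<in>\<P>. finite P \<and> P \<subseteq> topspace ?S"
    and dense: "\<forall>U. openin ?S U \<and> Y \<in> U \<longrightarrow> (\<exists>P\<in>\<P>. P \<subseteq> U)"
  have iff: "P \<subseteq> open_supersets X K \<longleftrightarrow> ?i P \<in> open_supersets X K"
    if "P \<in> \<P>" "Y \<in> open_supersets X K" for P K
  proof -
    have "K \<subseteq> topspace X"
      using that(2) openin_subset unfolding open_supersets_def by blast
    then show ?thesis
      using fin that(1) by (intro subset_open_supersets_iff_Inter) auto
  qed
  have "?i P \<in> topspace ?S" if "P \<in> \<P>" for P
    using fin that by (auto simp: open_subsets_def intro: openin_Int_Inter)
  then have carrier: "?i ` \<P> \<subseteq> topspace ?S"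
    by blast
  have "Y \<in> ?S closure_of (?i ` \<P>)"
    unfolding in_closure_of
  proof (intro conjI allI impI)
    show "Y \<in> topspace ?S"
      using assms(3) by simp
    fix U
    assume U: "Y \<in> U \<and> openin ?S U"
    obtain \<F> where \<F>: "finite \<F>" "\<F> \<subseteq> \<D>" "Y \<in> open_supersets X (\<Union>\<F>)"
        "open_supersets X (\<Union>\<F>) \<subseteq> U"
      by (rule openin_open_subsets_topology_obtain_basic[OF conjunct2[OF U] conjunct1[OF U]])
    then obtain P where P: "P \<in> \<P>" "P \<subseteq> open_supersets X (\<Union>\<F>)"
      using dense openin_open_supersets_Union[OF \<F>(1,2)] by blast
    then have "?i P \<in> U"
      using iff[OF P(1) \<F>(3)] \<F>(4) by (meson subsetD)
    then show "\<exists>y. y \<in> ?i ` \<P> \<and> y \<in> U"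
      using P(1) by (meson imageI)
  qed
  then obtain a where a: "range a \<subseteq> ?i ` \<P>" "limitin ?S a Y sequentially"
    using assms(4)[unfolded frechet_at_def] carrier by meson
  have "\<forall>n. \<exists>P\<in>\<P>. a n = ?i P"
    using a(1) by blast
  then obtain p where p: "\<And>n. p n \<in> \<P>" "\<And>n. a n = ?i (p n)"
    by metis
  have "\<forall>\<^sub>F n in sequentially. p n \<subseteq> U" if U: "openin ?S U" "Y \<in> U" for U
  proof -
    obtain \<F> where \<F>: "finite \<F>" "\<F> \<subseteq> \<D>" "Y \<in> open_supersets X (\<Union>\<F>)"
        "open_supersets X (\<Union>\<F>) \<subseteq> U"
      by (rule openin_open_subsets_topology_obtain_basic[OF U])
    have "\<forall>\<^sub>F n in sequentially. a n \<in> open_supersets X (\<Union>\<F>)"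
      using limitinD[OF a(2) openin_open_supersets_Union[OF \<F>(1,2)] \<F>(3)] .
    then show ?thesis
    proof eventually_elim
      case (elim n)
      then have "p n \<subseteq> open_supersets X (\<Union>\<F>)"
        using iff[OF p(1) \<F>(3)] p(2) by metis
      then show ?case
        using \<F>(4) by blast
    qed
  qed
  then show "\<exists>p :: nat \<Rightarrow> 'a set set. range p \<subseteq> \<P> \<and>
      (\<forall>U. openin ?S U \<and> Y \<in> U \<longrightarrow> (\<forall>\<^sub>F n in sequentially. p n \<subseteq> U))"
    using p(1) by (intro exI[of _ p] conjI) auto
qed

end
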